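(* Let $K$ be a field, let $n,p,q\ge 1$ and $k,m\ge 2$ be integers, and let $V\in K^{n\times pk}$ and $W\in K^{qm\times n}$ be given, partitioned into blocks as $$V=\begin{bmatrix} V_0 & V_1 & \dots & V_{k-1}\end{bmatrix},\qquad W=\begin{bmatrix} W_0^{T} & W_1^{T} & \dots & W_{m-1}^{T}\end{bmatrix}^{T},$$ with $V_i\in K^{n\times p}$ and $W_i\in K^{q\times n}$. Set $$V_L=\begin{bmatrix} V_0 & V_1 & \dots & V_{k-2}\end{bmatrix},\qquad V^U=\begin{bmatrix} V_1 & V_2 & \dots & V_{k-1}\end{bmatrix},$$ $$W_L=\begin{bmatrix} W_0\\ W_1\\ \vdots\\ W_{m-2}\end{bmatrix},\qquad W^U=\begin{bmatrix} W_1\\ W_2\\ \vdots\\ W_{m-1}\end{bmatrix}.$$ (i) There exists a triple $(A,B,C)\in K^{n\times n}\times K^{n\times p}\times K^{q\times n}$ such that $$V=R_k(A,B)\quad\text{and}\quad W=O_m(A,C)$$ if and only if the following three conditions hold: $$\operatorname{Ker} V_L\subseteq \operatorname{Ker} V^U,\qquad \operatorname{Im} W_L\supseteq \operatorname{Im} W^U,\qquad W_L V^U=W^U V_L.$$ (ii) Suppose the three conditions in (i) are satisfied, and let $V_L^{(1)}$ and $W_L^{(1)}$ be $\{1\}$-inverses of $V_L$ and $W_L$, respectively. Then a triple $(A,B,C)\in K^{n\times n}\times K^{n\times p}\times K^{q\times n}$ satisfies $V=R_k(A,B)$ and $W=O_m(A,C)$ if and only if $(B,C)=(V_0,W_0)$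 and $$A=W_L^{(1)}W^U+(I-W_L^{(1)}W_L)\,V^U V_L^{(1)}+(I-W_L^{(1)}W_L)\,Z\,(I-V_LV_L^{(1)})$$ for some $Z\in K^{n\times n}$.
   Context: For $A\in K^{n\times n}$, $B\in K^{n\times p}$, $C\in K^{q\times n}$, the $k$-step reachability matrix of $(A,B)$ is $$R_k(A,B)=\begin{bmatrix} B & AB & \dots & A^{k-1}B\end{bmatrix}\in K^{n\times pk},$$ and the $m$-step observability matrix of $(A,C)$ is $$O_m(A,C)=\begin{bmatrix} C\\ CA\\ \vdots\\ CA^{m-1}\end{bmatrix}\in K^{qm\times n}.$$ For $F\in K^{s\times t}$, a $\{1\}$-inverse of $F$, denoted $F^{(1)}$, is any matrix $Y\in K^{t\times s}$ with $FYF=F$. For a matrix $F\in K^{s\times t}$, $\operatorname{Ker}F=\{x\in K^t: Fx=0\}$ and $\operatorname{Im}F=\{Fx: x\in K^t\}$. $I$ denotes the $n\times n$ identity matrix. *)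

theory Defs
  imports "Jordan_Normal_Form.Matrix_Kernel"
begin

text \<open>The matrix \<open>[F 0, F 1, \<dots>, F (k-1)]\<close> made of \<open>k\<close> blocks \<open>F i\<close> of size \<open>n \<times> p\<close>.\<close>

definition block_row :: "nat \<Rightarrow> nat \<Rightarrow> nat \<Rightarrow> (nat \<Rightarrow> 'a mat) \<Rightarrow> 'a mat" where
  "block_row n p k F = mat n (p * k) (\<lambda>(i, j). F (j div p) $$ (i, j mod p))"

text \<open>The stack of \<open>F 0, F 1, \<dots>, F (m-1)\<close> made of \<open>m\<close> blocks \<open>F i\<close> of size \<open>q \<times> n\<close>.\<close>

definition block_col :: "nat \<Rightarrow> nat \<Rightarrow> nat \<Rightarrow> (nat \<Rightarrow> 'a mat) \<Rightarrow> 'a mat" where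
  "block_col q n m F = mat (q * m) n (\<lambda>(i, j). F (i div q) $$ (i mod q, j))"

definition reach_mat :: "nat \<Rightarrow> 'a::semiring_1 mat \<Rightarrow> 'a mat \<Rightarrow> 'a mat" where
  "reach_mat k A B = block_row (dim_row A) (dim_col B) k (\<lambda>i. A ^\<^sub>m i * B)"

definition obs_mat :: "nat \<Rightarrow> 'a::semiring_1 mat \<Rightarrow> 'a mat \<Rightarrow> 'a mat" where
  "obs_mat m A C = block_col (dim_row C) (dim_col A) m (\<lambda>i. C * A ^\<^sub>m i)"

definition one_inverse :: "'a::semiring_0 mat \<Rightarrow> 'a mat \<Rightarrow> bool" where
  "one_inverse F Y \<longleftrightarrow> Y \<in> carrier_mat (dim_col F) (dim_row F) \<and> F * Y * F = F"

definition mat_image :: "'a::semiring_0 mat \<Rightarrow> 'a vec set" where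
  "mat_image F = {F *\<^sub>v x | x. x \<in> carrier_vec (dim_col F)}"

text \<open>Every matrix of the right size has a partition into blocks, and it is unique.\<close>

lemma block_row_partition:
  assumes "V \<in> carrier_mat n (p * k)"
  shows "\<exists>F. (\<forall>i<k. F i \<in> carrier_mat n p) \<and> V = block_row n p k F"
proof (intro exI conjI)
  let ?F = "\<lambda>i. mat n p (\<lambda>(r, c). V $$ (r, p * i + c))"
  show "\<forall>i<k. ?F i \<in> carrier_mat n p" by simp
  show "V = block_row n p k ?F"
  proof (rule eq_matI)
    fix r c assume "r < dim_row (block_row n p k ?F)" "c < dim_col (block_row n p k ?F)"
    moreover from this have "p > 0" by (cases p) (simp_all add: block_row_def)
    ultimately show "V $$ (r, c) = block_row n p k ?F $$ (r, c)"
      by (simp add: block_row_def)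
  qed (use assms in \<open>auto simp: block_row_def\<close>)
qed

lemma block_col_partition:
  assumes "W \<in> carrier_mat (q * m) n"
  shows "\<exists>F. (\<forall>i<m. F i \<in> carrier_mat q n) \<and> W = block_col q n m F"
proof (intro exI conjI)
  let ?F = "\<lambda>i. mat q n (\<lambda>(r, c). W $$ (q * i + r, c))"
  show "\<forall>i<m. ?F i \<in> carrier_mat q n" by simp
  show "W = block_col q n m ?F"
  proof (rule eq_matI)
    fix r c assume "r < dim_row (block_col q n m ?F)" "c < dim_col (block_col q n m ?F)"
    moreover from this have "q > 0" by (cases q) (simp_all add: block_col_def)
    ultimately show "W $$ (r, c) = block_col q n m ?F $$ (r, c)"
      by (simp add: block_col_def)
  qed (use assms in \<open>auto simp: block_col_def\<close>)
qed

lemma block_row_nth: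
  assumes "F i \<in> carrier_mat n p" "i < k"
  shows "F i = mat n p (\<lambda>(r, c). block_row n p k F $$ (r, p * i + c))"
proof (rule eq_matI; simp)
  fix r c assume "r < n" "c < p"
  moreover have "p * i + c < p * k"
  proof -
    have "p * i + c < p * Suc i" using \<open>c < p\<close> by simp
    also have "\<dots> \<le> p * k" using assms(2) by (intro mult_le_mono2) simp
    finally show ?thesis .
  qed
  ultimately show "F i $$ (r, c) = block_row n p k F $$ (r, p * i + c)"
    by (simp add: block_row_def)
qed (use assms in auto)

lemma block_col_nth:
  assumes "F i \<in> carrier_mat q n" "i < m"
  shows "F i = mat q n (\<lambda>(r, c). block_col q n m F $$ (q * i + r, c))"
proof (rule eq_matI; simp)
  fix r c assume "r < q" "c < n"
  moreover have "q * i + r < q * m"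
  proof -
    have "q * i + r < q * Suc i" using \<open>r < q\<close> by simp
    also have "\<dots> \<le> q * m" using assms(2) by (intro mult_le_mono2) simp
    finally show ?thesis .
  qed
  ultimately show "F i $$ (r, c) = block_col q n m F $$ (q * i + r, c)"
    by (simp add: block_col_def)
qed (use assms in auto)

end

theory Submission
  imports Defs
begin

text \<open>
  Multiplying \<open>[B, AB, \<dots>]\<close> by \<open>A\<close> on the left shifts its blocks by one place, and so does multiplying
  the stack of \<open>C, CA, \<dots>\<close> by \<open>A\<close> on the right.  Hence the triple \<open>(A, B, C)\<close> realises \<open>(V, W)\<close>
  exactly if \<open>B = V\<^sub>0\<close>, \<open>C = W\<^sub>0\<close> and \<open>A\<close> solves the two linear equations \<open>A V\<^sub>L = V\<^sub>U\<close> and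
  \<open>W\<^sub>L A = W\<^sub>U\<close> (lemma \<open>realises_iff\<close>); the powers of \<open>A\<close> have disappeared from the problem.

  What remains is the classical pair of equations \<open>X R = S\<close>, \<open>P X = Q\<close>.  A solution forces
  \<open>Ker R \<subseteq> Ker S\<close>, \<open>Im Q \<subseteq> Im P\<close> and \<open>P S = P X R = Q R\<close>.  Conversely, given \<open>{1}\<close>-inverses of \<open>R\<close>
  and \<open>P\<close>, the first two conditions say \<open>S R\<^sup>- R = S\<close> and \<open>P P\<^sup>- Q = Q\<close>, that is, each equation is
  solvable on its own.  With the third one, the formula of part (ii) solves both equations for every
  \<open>Z\<close>, and it gives every solution \<open>X\<close>, because it returns \<open>X\<close> for \<open>Z = X\<close> (lemma
  \<open>common_solution_iff\<close>).  Part (i) then follows as soon as every matrix over a field has a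
  \<open>{1}\<close>-inverse; one is read off from the reduced row echelon form (lemma \<open>one_inverse_exists\<close>).
\<close>

section \<open>Existence of \<open>{1}\<close>-inverses\<close>

text \<open>The matrix \<open>Y\<close> that sends the unit vector of each nonzero row to the unit vector of its pivot
  column satisfies \<open>E * Y = diag(1, \<dots>, 1, 0, \<dots>, 0)\<close> with a one for each nonzero row of the echelon
  form \<open>E\<close>; this diagonal matrix fixes \<open>E\<close>.\<close>

lemma row_echelon_one_inverse:
  fixes E :: "'a::field mat"
  assumes E: "E \<in> carrier_mat r c" and ech: "row_echelon_form E"
  shows "\<exists>Y \<in> carrier_mat c r. E * Y * E = E"
proof -
  from ech E obtain f where f: "pivot_fun E f c"
    unfolding row_echelon_form_def by auto
  have dim: "dim_row E = r" using E by simp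
  note piv = pivot_funD[OF dim f]
  define Y :: "'a mat" where "Y = mat c r (\<lambda>(j, i). if j = f i then 1 else 0)"
  have Y: "Y \<in> carrier_mat c r" by (simp add: Y_def)
  \<comment> \<open>A zero row \<open>i\<close> has \<open>f i = c\<close>, which is not a column index.\<close>
  define D :: "'a mat" where "D = mat r r (\<lambda>(i, j). if i = j \<and> f i < c then 1 else 0)"
  have EY: "E * Y = D"
  proof (rule eq_matI)
    fix i j assume "i < dim_row D" "j < dim_col D"
    then have ij: "i < r" "j < r" by (auto simp: D_def)
    have "(E * Y) $$ (i, j) = (\<Sum>l = 0..<c. E $$ (i, l) * (if l = f j then 1 else 0))"
      using ij E Y by (simp add: scalar_prod_def Y_def)
    also have "\<dots> = (if f j < c then E $$ (i, f j) else 0)"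
      by (simp add: if_distrib cong: if_cong)
    also have "\<dots> = D $$ (i, j)"
      using ij piv(4,5) by (auto simp: D_def)
    finally show "(E * Y) $$ (i, j) = D $$ (i, j)" .
  qed (use E Y in \<open>auto simp: D_def\<close>)
  have "D * E = E"
  proof (rule eq_matI)
    fix i j assume "i < dim_row E" "j < dim_col E"
    then have ij: "i < r" "j < c" using E by auto
    have "(D * E) $$ (i, j) = (\<Sum>l = 0..<r. (if l = i then if f i < c then 1 else 0 else 0) * E $$ (l, j))"
      using ij E by (auto simp: scalar_prod_def D_def intro!: sum.cong)
    also have "\<dots> = (if f i < c then E $$ (i, j) else 0)"
      using ij by (simp add: if_distrib[of "\<lambda>x. x * _"] cong: if_cong)
    also have "\<dots> = E $$ (i, j)"
      using ij piv(1,2)[of i] by auto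
    finally show "(D * E) $$ (i, j) = E $$ (i, j)" .
  qed (use E in \<open>auto simp: D_def\<close>)
  with EY Y show ?thesis by auto
qed

text \<open>If \<open>E = P F\<close> with \<open>P\<close> invertible and \<open>Y\<close> is a \<open>{1}\<close>-inverse of \<open>E\<close>, then cancelling \<open>P\<close> in
  \<open>P F Y P F = P F\<close> shows that \<open>Y P\<close> is one of \<open>F\<close>.\<close>

lemma one_inverse_exists:
  fixes F :: "'a::field mat"
  shows "\<exists>Y. one_inverse F Y"
proof -
  define r c where "r = dim_row F" and "c = dim_col F"
  have F: "F \<in> carrier_mat r c" by (simp add: r_def c_def)
  \<comment> \<open>The second argument only records the row operations; a matrix without columns will do.\<close>
  obtain E E' where g: "gauss_jordan F (0\<^sub>m r 0) = (E, E')" by force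
  have E: "E \<in> carrier_mat r c" by (rule gauss_jordan_carrier(1)[OF F zero_carrier_mat g])
  from gauss_jordan_transform[OF F zero_carrier_mat g, of undefined]
  obtain P where "P \<in> Units (ring_mat TYPE('a) r undefined)" and EP: "E = P * F" by auto
  then obtain P' where P: "P \<in> carrier_mat r r" and P': "P' \<in> carrier_mat r r"
    and inv: "P' * P = 1\<^sub>m r"
    unfolding Units_def ring_mat_def by auto
  from row_echelon_one_inverse[OF E gauss_jordan_row_echelon[OF F g]]
  obtain Y where Y: "Y \<in> carrier_mat c r" and EYE: "E * Y * E = E" by auto
  have P'E: "P' * E = F"
    using assoc_mult_mat[OF P' P F, symmetric] inv F by (simp add: EP)
  have "F * (Y * P) * F = F * (Y * E)"
    using F Y P by (simp add: EP assoc_mult_mat[of _ _ c _ r])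
  also have "\<dots> = P' * (E * Y * E)"
    using P' E Y by (simp add: P'E[symmetric] assoc_mult_mat[of _ r r _ c _ c])
  also have "\<dots> = F" by (simp add: EYE P'E)
  finally have "one_inverse F (Y * P)"
    using F Y P by (auto simp: one_inverse_def)
  then show ?thesis ..
qed

section \<open>Kernel and image inclusions as matrix equations\<close>

lemma kernel_subset_imp_mult_zero:
  fixes R S N :: "'a::field mat"
  assumes R: "R \<in> carrier_mat a s" and S: "S \<in> carrier_mat b s" and N: "N \<in> carrier_mat s l"
    and ker: "mat_kernel R \<subseteq> mat_kernel S" and RN: "R * N = 0\<^sub>m a l"
  shows "S * N = 0\<^sub>m b l"
proof (rule mat_col_eqI)
  fix j assume "j < dim_col (0\<^sub>m b l :: 'a mat)"
  then have j: "j < l" by simp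
  have "R *\<^sub>v col N j = 0\<^sub>v a"
    using col_mult2[OF R N j] RN j by simp
  then have "col N j \<in> mat_kernel R"
    using N j by (intro mat_kernelI[OF R]) auto
  then have "S *\<^sub>v col N j = 0\<^sub>v b"
    using ker mat_kernelD[OF S] by blast
  then show "col (S * N) j = col (0\<^sub>m b l) j"
    using col_mult2[OF S N j] j by simp
qed (use S N in auto)

text \<open>The columns of \<open>I - R\<^sup>- R\<close> lie in the kernel of \<open>R\<close>, hence in that of \<open>S\<close>.\<close>

lemma kernel_subset_imp_factor:
  fixes R S :: "'a::field mat"
  assumes R: "R \<in> carrier_mat a s" and S: "S \<in> carrier_mat b s"
    and Y: "one_inverse R Y" and ker: "mat_kernel R \<subseteq> mat_kernel S"
  shows "S * Y * R = S"
proof -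
  have Yc: "Y \<in> carrier_mat s a" and RYR: "R * Y * R = R"
    using Y R by (auto simp: one_inverse_def)
  have "R * (1\<^sub>m s - Y * R) = R - R * Y * R"
    using R Yc by (simp add: mult_minus_distrib_mat[of _ a s _ s])
  also have "\<dots> = 0\<^sub>m a s" using RYR R by simp
  finally have "S * (1\<^sub>m s - Y * R) = 0\<^sub>m b s"
    using R Yc by (intro kernel_subset_imp_mult_zero[OF R S _ ker]) auto
  moreover have "S * (1\<^sub>m s - Y * R) = S - S * Y * R"
    using S R Yc by (simp add: mult_minus_distrib_mat[of _ b s _ s])
  ultimately have z: "S - S * Y * R = 0\<^sub>m b s" by simp
  show ?thesis
  proof (rule eq_matI)
    fix i j assume ij: "i < dim_row S" "j < dim_col S"
    then have "(S - S * Y * R) $$ (i, j) = S $$ (i, j) - (S * Y * R) $$ (i, j)"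
      using S R Yc by (intro index_minus_mat) auto
    then show "(S * Y * R) $$ (i, j) = S $$ (i, j)"
      using z ij S by simp
  qed (use S R in auto)
qed

text \<open>\<open>P P\<^sup>-\<close> fixes every vector \<open>P x\<close>, and each column of \<open>Q\<close> is such a vector.\<close>

lemma image_subset_imp_factor:
  fixes P Q :: "'a::field mat"
  assumes P: "P \<in> carrier_mat t a" and Q: "Q \<in> carrier_mat t b"
    and Y: "one_inverse P Y" and im: "mat_image Q \<subseteq> mat_image P"
  shows "P * Y * Q = Q"
proof (rule mat_col_eqI)
  have Yc: "Y \<in> carrier_mat a t" and PYP: "P * Y * P = P"
    using Y P by (auto simp: one_inverse_def)
  fix j assume "j < dim_col Q"
  then have j: "j < b" using Q by simp
  have "Q *\<^sub>v unit_vec b j \<in> mat_image Q"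
    using Q by (auto simp: mat_image_def)
  moreover have "Q *\<^sub>v unit_vec b j = col Q j"
    using col_mult2[OF Q one_carrier_mat j] Q j by simp
  ultimately obtain x where x: "x \<in> carrier_vec a" and Qx: "col Q j = P *\<^sub>v x"
    using im P by (auto simp: mat_image_def)
  have "col (P * Y * Q) j = P * Y *\<^sub>v (P *\<^sub>v x)"
    using col_mult2[of "P * Y" t t Q b j] P Yc Q j Qx by simp
  also have "\<dots> = P * Y * P *\<^sub>v x"
    using P Yc x by (intro assoc_mult_mat_vec[symmetric]) auto
  also have "\<dots> = col Q j" by (simp only: PYP Qx)
  finally show "col (P * Y * Q) j = col Q j" .
qed (use P Q in auto)

section \<open>The pair of equations \<open>X R = S\<close> and \<open>P X = Q\<close>\<close>

lemma common_solution_necessary: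
  fixes P Q R S X :: "'a::field mat"
  assumes R: "R \<in> carrier_mat b s" and P: "P \<in> carrier_mat t a" and X: "X \<in> carrier_mat a b"
    and XR: "X * R = S" and PX: "P * X = Q"
  shows "mat_kernel R \<subseteq> mat_kernel S" "mat_image Q \<subseteq> mat_image P" "P * S = Q * R"
proof -
  show "mat_kernel R \<subseteq> mat_kernel S"
    using mat_kernel_mult_subset[OF R X] by (simp add: XR)
  show "mat_image Q \<subseteq> mat_image P"
  proof
    fix y assume "y \<in> mat_image Q"
    then obtain x where x: "x \<in> carrier_vec b" and "y = P * X *\<^sub>v x"
      using X by (auto simp: mat_image_def PX[symmetric])
    then have "y = P *\<^sub>v (X *\<^sub>v x)" using P X x by simp
    moreover have "X *\<^sub>v x \<in> carrier_vec (dim_col P)" using P X x by auto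
    ultimately show "y \<in> mat_image P" by (auto simp: mat_image_def)
  qed
  show "P * S = Q * R"
    using P X R by (simp add: XR[symmetric] PX[symmetric])
qed

text \<open>The projections \<open>G = I - P\<^sup>- P\<close> and \<open>H = I - R R\<^sup>-\<close> satisfy \<open>P G = 0\<close> and \<open>H R = 0\<close>, so the term
  with \<open>Z\<close> solves both homogeneous equations, and \<open>P\<^sup>- Q + G S R\<^sup>-\<close> is a particular solution.  Every
  \<open>X\<close> equals \<open>P\<^sup>- P X + G X R R\<^sup>- + G X H\<close>; for a solution, this is the formula with \<open>Z = X\<close>.\<close>

lemma common_solution_iff:
  fixes P Q R S X :: "'a::field mat"
  assumes R: "R \<in> carrier_mat b s" and S: "S \<in> carrier_mat a s"
    and P: "P \<in> carrier_mat t a" and Q: "Q \<in> carrier_mat t b" and X: "X \<in> carrier_mat a b"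
    and R1: "one_inverse R R1" and P1: "one_inverse P P1"
    and ker: "mat_kernel R \<subseteq> mat_kernel S" and im: "mat_image Q \<subseteq> mat_image P"
    and PS: "P * S = Q * R"
  shows "X * R = S \<and> P * X = Q \<longleftrightarrow>
    (\<exists>Z \<in> carrier_mat a b.
      X = P1 * Q + (1\<^sub>m a - P1 * P) * S * R1 + (1\<^sub>m a - P1 * P) * Z * (1\<^sub>m b - R * R1))"
    (is "_ \<longleftrightarrow> (\<exists>Z \<in> _. X = ?X Z)")
proof -
  have R1c: "R1 \<in> carrier_mat s b" and RRR: "R * R1 * R = R"
    using R1 R by (auto simp: one_inverse_def)
  have P1c: "P1 \<in> carrier_mat a t" and PPP: "P * P1 * P = P"
    using P1 P by (auto simp: one_inverse_def)
  have SRR: "S * R1 * R = S" by (rule kernel_subset_imp_factor[OF R S R1 ker])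
  have PPQ: "P * P1 * Q = Q" by (rule image_subset_imp_factor[OF P Q P1 im])
  define G where "G = 1\<^sub>m a - P1 * P"
  define H where "H = 1\<^sub>m b - R * R1"
  have G: "G \<in> carrier_mat a a" using P P1c by (auto simp: G_def)
  have H: "H \<in> carrier_mat b b" using R R1c by (auto simp: H_def)
  have GM: "G * M = M - P1 * (P * M)" if "M \<in> carrier_mat a l" for M and l
    using that P P1c by (simp add: G_def minus_mult_distrib_mat[of _ a a _ _ l])
  have "P * G = P - P * P1 * P"
    using P P1c by (simp add: G_def mult_minus_distrib_mat[of _ t a _ a])
  then have PG: "P * G = 0\<^sub>m t a" using PPP P by simp
  have "H * R = R - R * R1 * R"
    using R R1c by (simp add: H_def minus_mult_distrib_mat[of _ b b _ _ s])
  then have HR: "H * R = 0\<^sub>m b s" using RRR R by simp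
  show ?thesis
    unfolding G_def[symmetric] H_def[symmetric]
  proof
    assume "X * R = S \<and> P * X = Q"
    then have XR: "X * R = S" and PX: "P * X = Q" by auto
    have XH: "X * H = X - S * R1"
      using X R R1c by (simp add: H_def mult_minus_distrib_mat[of _ a b _ b] XR[symmetric])
    have "G * S * R1 + G * X * H = G * (S * R1 + X * H)"
      using G S R1c X H by (simp add: mult_add_distrib_mat[of _ a a _ b])
    also have "S * R1 + X * H = X"
      unfolding XH using X S R1c by (intro eq_matI) auto
    also have "G * X = X - P1 * Q" using GM[OF X] PX by simp
    finally have GSX: "G * S * R1 + G * X * H = X - P1 * Q" .
    have "P1 * Q + G * S * R1 + G * X * H = P1 * Q + (G * S * R1 + G * X * H)"
      using P1c Q G S R1c X H by (intro assoc_add_mat[of _ a b]) auto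
    also have "\<dots> = X"
      unfolding GSX using P1c Q X by (intro eq_matI) auto
    finally have "X = P1 * Q + G * S * R1 + G * X * H" ..
    with X show "\<exists>Z \<in> carrier_mat a b. X = P1 * Q + G * S * R1 + G * Z * H" by blast
  next
    assume "\<exists>Z \<in> carrier_mat a b. X = P1 * Q + G * S * R1 + G * Z * H"
    then obtain Z where Z: "Z \<in> carrier_mat a b"
      and X_eq: "X = P1 * Q + G * S * R1 + G * Z * H" by auto
    have c: "P1 * Q \<in> carrier_mat a b" "G * S * R1 \<in> carrier_mat a b" "G * Z * H \<in> carrier_mat a b"
      using P1c Q G S R1c Z H by auto
    have "X * R = P1 * Q * R + G * S * R1 * R + G * Z * H * R"
      using c R by (simp add: X_eq add_mult_distrib_mat[of _ a b _ _ s] del: assoc_mult_mat assoc_add_mat)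
    also have "G * S * R1 * R = G * (S * R1 * R)"
      using G S R1c R by (simp add: assoc_mult_mat[of _ a a _ b _ s])
    also have "\<dots> = S - P1 * Q * R"
      using GM[OF S] PS P1c Q R by (simp only: SRR) simp
    also have "G * Z * H * R = 0\<^sub>m a s"
      using G Z H R HR by (simp add: assoc_mult_mat[of _ a a _ b _ s])
    also have "P1 * Q * R + (S - P1 * Q * R) + 0\<^sub>m a s = S"
      using P1c Q R S by (intro eq_matI) auto
    finally have "X * R = S" .
    moreover
    have "P * (G * M) = 0\<^sub>m t l" if "M \<in> carrier_mat a l" for M and l
      using assoc_mult_mat[OF P G that] PG that by simp
    from this[of "S * R1" b] this[of "Z * H" b]
    have "P * (G * S * R1) = 0\<^sub>m t b" "P * (G * Z * H) = 0\<^sub>m t b"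
      using G S R1c Z H by auto
    then have "P * X = P * (P1 * Q)"
      using c P by (simp add: X_eq mult_add_distrib_mat[of _ t a _ b])
    then have "P * X = Q" using PPQ P P1c Q by simp
    ultimately show "X * R = S \<and> P * X = Q" ..
  qed
qed

section \<open>Reachability and observability matrices as shift equations\<close>

lemma block_row_carrier [simp]: "block_row n p k F \<in> carrier_mat n (p * k)"
  by (simp add: block_row_def)

lemma block_col_carrier [simp]: "block_col q n m F \<in> carrier_mat (q * m) n"
  by (simp add: block_col_def)

lemma block_row_eq_iff:
  assumes F: "\<And>i. i < k \<Longrightarrow> F i \<in> carrier_mat n p" and G: "\<And>i. i < k \<Longrightarrow> G i \<in> carrier_mat n p"
  shows "block_row n p k F = block_row n p k G \<longleftrightarrow> (\<forall>i<k. F i = G i)"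
proof
  assume "block_row n p k F = block_row n p k G"
  then show "\<forall>i<k. F i = G i"
    using block_row_nth[of F _ n p k] block_row_nth[of G _ n p k] F G by metis
next
  assume eq: "\<forall>i<k. F i = G i"
  have "j div p < k" if "j < p * k" for j
    using that by (simp add: less_mult_imp_div_less mult.commute)
  then show "block_row n p k F = block_row n p k G"
    using eq by (intro eq_matI) (auto simp: block_row_def)
qed

lemma block_col_eq_iff:
  assumes F: "\<And>i. i < m \<Longrightarrow> F i \<in> carrier_mat q n" and G: "\<And>i. i < m \<Longrightarrow> G i \<in> carrier_mat q n"
  shows "block_col q n m F = block_col q n m G \<longleftrightarrow> (\<forall>i<m. F i = G i)"
proof
  assume "block_col q n m F = block_col q n m G"
  then show "\<forall>i<m. F i = G i"
    using block_col_nth[of F _ q n m] block_col_nth[of G _ q n m] F G by metis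
next
  assume eq: "\<forall>i<m. F i = G i"
  have "j div q < m" if "j < q * m" for j
    using that by (simp add: less_mult_imp_div_less mult.commute)
  then show "block_col q n m F = block_col q n m G"
    using eq by (intro eq_matI) (auto simp: block_col_def)
qed

lemma mult_block_row:
  assumes A: "A \<in> carrier_mat a n" and F: "\<And>i. i < k \<Longrightarrow> F i \<in> carrier_mat n p"
  shows "A * block_row n p k F = block_row a p k (\<lambda>i. A * F i)"
proof (rule eq_matI)
  fix r c assume "r < dim_row (block_row a p k (\<lambda>i. A * F i))"
    "c < dim_col (block_row a p k (\<lambda>i. A * F i))"
  then have r: "r < a" and c: "c < p * k" by (auto simp: block_row_def)
  have "c div p < k" "c mod p < p"
    using c by (auto simp: less_mult_imp_div_less mult.commute intro!: mod_less_divisor gr0I)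
  with r c F[of "c div p"] A show
    "(A * block_row n p k F) $$ (r, c) = block_row a p k (\<lambda>i. A * F i) $$ (r, c)"
    by (auto simp: block_row_def scalar_prod_def)
qed (use A in \<open>auto simp: block_row_def\<close>)

lemma block_col_mult:
  assumes A: "A \<in> carrier_mat n b" and F: "\<And>i. i < m \<Longrightarrow> F i \<in> carrier_mat q n"
  shows "block_col q n m F * A = block_col q b m (\<lambda>i. F i * A)"
proof (rule eq_matI)
  fix r c assume "r < dim_row (block_col q b m (\<lambda>i. F i * A))"
    "c < dim_col (block_col q b m (\<lambda>i. F i * A))"
  then have r: "r < q * m" and c: "c < b" by (auto simp: block_col_def)
  have "r div q < m" "r mod q < q"
    using r by (auto simp: less_mult_imp_div_less mult.commute intro!: mod_less_divisor gr0I)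
  with r c F[of "r div q"] A show
    "(block_col q n m F * A) $$ (r, c) = block_col q b m (\<lambda>i. F i * A) $$ (r, c)"
    by (auto simp: block_col_def scalar_prod_def)
qed (use A in \<open>auto simp: block_col_def\<close>)

lemma pow_mat_Suc_left:
  fixes A :: "'a::semiring_1 mat"
  assumes A: "A \<in> carrier_mat n n"
  shows "A ^\<^sub>m Suc i = A * A ^\<^sub>m i"
proof (induction i)
  case 0
  then show ?case using A by simp
next
  case (Suc i)
  have "A ^\<^sub>m Suc (Suc i) = A * A ^\<^sub>m i * A" using Suc.IH by simp
  also have "\<dots> = A * A ^\<^sub>m Suc i"
    using assoc_mult_mat[OF A pow_carrier_mat[OF A] A] by simp
  finally show ?case .
qed

text \<open>Blockwise, \<open>F i = A\<^sup>i B\<close> for all \<open>i < k\<close> is the solution of the recursion \<open>F 0 = B\<close>,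
  \<open>F (i + 1) = A F i\<close>; the recursion steps for \<open>i < k - 1\<close> are the blocks of one matrix equation.\<close>

lemma reach_mat_eq_iff:
  fixes A B :: "'a::field mat"
  assumes k: "k \<ge> 1" and F: "\<And>i. i < k \<Longrightarrow> F i \<in> carrier_mat n p"
    and A: "A \<in> carrier_mat n n" and B: "B \<in> carrier_mat n p"
  shows "block_row n p k F = reach_mat k A B \<longleftrightarrow>
    B = F 0 \<and> A * block_row n p (k - 1) F = block_row n p (k - 1) (\<lambda>i. F (i + 1))"
proof -
  have step: "A ^\<^sub>m Suc i * B = A * (A ^\<^sub>m i * B)" for i
    using A B by (simp only: pow_mat_Suc_left[OF A])
      (intro assoc_mult_mat[of _ n n _ n _ p], auto)
  have "block_row n p k F = reach_mat k A B \<longleftrightarrow> (\<forall>i<k. F i = A ^\<^sub>m i * B)"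
    using A B F block_row_eq_iff[of k F n p "\<lambda>i. A ^\<^sub>m i * B"]
      mult_carrier_mat[OF pow_carrier_mat[OF A] B] by (simp add: reach_mat_def)
  also have "\<dots> \<longleftrightarrow> B = F 0 \<and> (\<forall>i<k - 1. A * F i = F (i + 1))"
  proof (intro iffI conjI allI impI)
    assume *: "\<forall>i<k. F i = A ^\<^sub>m i * B"
    show "B = F 0" using * k A B by simp
    fix i assume "i < k - 1"
    then show "A * F i = F (i + 1)" using * step[of i] by simp
  next
    fix i
    assume *: "B = F 0 \<and> (\<forall>i<k - 1. A * F i = F (i + 1))" and "i < k"
    from \<open>i < k\<close> show "F i = A ^\<^sub>m i * B"
    proof (induction i)
      case 0
      then show ?case using * A B by simp
    next
      case (Suc i)
      have "F (Suc i) = A * F i" using * Suc.prems by simp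
      with Suc step[of i] show ?case by simp
    qed
  qed
  also have "(\<forall>i<k - 1. A * F i = F (i + 1)) \<longleftrightarrow>
      A * block_row n p (k - 1) F = block_row n p (k - 1) (\<lambda>i. F (i + 1))"
  proof -
    have "A * block_row n p (k - 1) F = block_row n p (k - 1) (\<lambda>i. A * F i)"
      using A F by (intro mult_block_row) auto
    moreover have "block_row n p (k - 1) (\<lambda>i. A * F i) = block_row n p (k - 1) (\<lambda>i. F (i + 1))
        \<longleftrightarrow> (\<forall>i<k - 1. A * F i = F (i + 1))"
    proof (rule block_row_eq_iff)
      fix i assume i: "i < k - 1"
      show "A * F i \<in> carrier_mat n p" using A F[of i] i by simp
      show "F (i + 1) \<in> carrier_mat n p" using F[of "i + 1"] i by simp
    qed
    ultimately show ?thesis by simp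
  qed
  finally show ?thesis .
qed

lemma obs_mat_eq_iff:
  fixes A C :: "'a::field mat"
  assumes m: "m \<ge> 1" and F: "\<And>i. i < m \<Longrightarrow> F i \<in> carrier_mat q n"
    and A: "A \<in> carrier_mat n n" and C: "C \<in> carrier_mat q n"
  shows "block_col q n m F = obs_mat m A C \<longleftrightarrow>
    C = F 0 \<and> block_col q n (m - 1) F * A = block_col q n (m - 1) (\<lambda>i. F (i + 1))"
proof -
  have step: "C * A ^\<^sub>m Suc i = C * A ^\<^sub>m i * A" for i
    using A C by (simp add: assoc_mult_mat[of _ q n _ n _ n])
  have "block_col q n m F = obs_mat m A C \<longleftrightarrow> (\<forall>i<m. F i = C * A ^\<^sub>m i)"
    using A C F block_col_eq_iff[of m F q n "\<lambda>i. C * A ^\<^sub>m i"]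
      mult_carrier_mat[OF C pow_carrier_mat[OF A]] by (simp add: obs_mat_def)
  also have "\<dots> \<longleftrightarrow> C = F 0 \<and> (\<forall>i<m - 1. F i * A = F (i + 1))"
  proof (intro iffI conjI allI impI)
    assume *: "\<forall>i<m. F i = C * A ^\<^sub>m i"
    show "C = F 0" using * m A C by simp
    fix i assume "i < m - 1"
    then show "F i * A = F (i + 1)" using * step[of i] by simp
  next
    fix i
    assume *: "C = F 0 \<and> (\<forall>i<m - 1. F i * A = F (i + 1))" and "i < m"
    from \<open>i < m\<close> show "F i = C * A ^\<^sub>m i"
    proof (induction i)
      case 0
      then show ?case using * A C by simp
    next
      case (Suc i)
      have "F (Suc i) = F i * A" using * Suc.prems by simp
      with Suc step[of i] show ?case by simp
    qed
  qed
  also have "(\<forall>i<m - 1. F i * A = F (i + 1)) \<longleftrightarrow>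
      block_col q n (m - 1) F * A = block_col q n (m - 1) (\<lambda>i. F (i + 1))"
  proof -
    have "block_col q n (m - 1) F * A = block_col q n (m - 1) (\<lambda>i. F i * A)"
      using A F by (intro block_col_mult) auto
    moreover have "block_col q n (m - 1) (\<lambda>i. F i * A) = block_col q n (m - 1) (\<lambda>i. F (i + 1))
        \<longleftrightarrow> (\<forall>i<m - 1. F i * A = F (i + 1))"
    proof (rule block_col_eq_iff)
      fix i assume i: "i < m - 1"
      show "F i * A \<in> carrier_mat q n" using i by (intro mult_carrier_mat[OF F A]) simp
      show "F (i + 1) \<in> carrier_mat q n" using F[of "i + 1"] i by simp
    qed
    ultimately show ?thesis by simp
  qed
  finally show ?thesis .
qed

lemma realises_iff:
  fixes A B C :: "'a::field mat"
  assumes "k \<ge> 1" "m \<ge> 1"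
    and "\<And>i. i < k \<Longrightarrow> F i \<in> carrier_mat n p" "\<And>i. i < m \<Longrightarrow> G i \<in> carrier_mat q n"
    and "A \<in> carrier_mat n n" "B \<in> carrier_mat n p" "C \<in> carrier_mat q n"
  shows "block_row n p k F = reach_mat k A B \<and> block_col q n m G = obs_mat m A C \<longleftrightarrow>
    (B, C) = (F 0, G 0)
    \<and> A * block_row n p (k - 1) F = block_row n p (k - 1) (\<lambda>i. F (i + 1))
    \<and> block_col q n (m - 1) G * A = block_col q n (m - 1) (\<lambda>i. G (i + 1))"
  using reach_mat_eq_iff[of k F n p A B] obs_mat_eq_iff[of m G q n A C] assms by auto

section \<open>Realisations of a given pair of matrices\<close>

theorem theorem2p2:
  fixes n p q k m :: nat
    and V W V\<^sub>L V\<^sub>U W\<^sub>L W\<^sub>U :: "'a::field mat"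
    and Vb Wb :: "nat \<Rightarrow> 'a mat"
  assumes "n \<ge> 1" "p \<ge> 1" "q \<ge> 1" "k \<ge> 2" "m \<ge> 2"
    and "V \<in> carrier_mat n (p * k)" "W \<in> carrier_mat (q * m) n"
    and "\<And>i. i < k \<Longrightarrow> Vb i \<in> carrier_mat n p" "V = block_row n p k Vb"
    and "\<And>i. i < m \<Longrightarrow> Wb i \<in> carrier_mat q n" "W = block_col q n m Wb"
  defines "V\<^sub>L \<equiv> block_row n p (k - 1) Vb"
    and "V\<^sub>U \<equiv> block_row n p (k - 1) (\<lambda>i. Vb (i + 1))"
    and "W\<^sub>L \<equiv> block_col q n (m - 1) Wb"
    and "W\<^sub>U \<equiv> block_col q n (m - 1) (\<lambda>i. Wb (i + 1))"
  shows "((\<exists>A \<in> carrier_mat n n. \<exists>B \<in> carrier_mat n p. \<exists>C \<in> carrier_mat q n.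
            V = reach_mat k A B \<and> W = obs_mat m A C)
          \<longleftrightarrow> mat_kernel V\<^sub>L \<subseteq> mat_kernel V\<^sub>U
            \<and> mat_image W\<^sub>L \<supseteq> mat_image W\<^sub>U
            \<and> W\<^sub>L * V\<^sub>U = W\<^sub>U * V\<^sub>L)
       \<and> (mat_kernel V\<^sub>L \<subseteq> mat_kernel V\<^sub>U
            \<and> mat_image W\<^sub>L \<supseteq> mat_image W\<^sub>U
            \<and> W\<^sub>L * V\<^sub>U = W\<^sub>U * V\<^sub>L
          \<longrightarrow> (\<forall>V1 W1. one_inverse V\<^sub>L V1 \<and> one_inverse W\<^sub>L W1 \<longrightarrow>
                (\<forall>A \<in> carrier_mat n n. \<forall>B \<in> carrier_mat n p. \<forall>C \<in> carrier_mat q n.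
                  V = reach_mat k A B \<and> W = obs_mat m A C
                  \<longleftrightarrow> (B, C) = (Vb 0, Wb 0)
                    \<and> (\<exists>Z \<in> carrier_mat n n.
                        A = W1 * W\<^sub>U
                          + (1\<^sub>m n - W1 * W\<^sub>L) * V\<^sub>U * V1
                          + (1\<^sub>m n - W1 * W\<^sub>L) * Z * (1\<^sub>m n - V\<^sub>L * V1)))))"
    (is "(?ex \<longleftrightarrow> ?cond) \<and> (?cond \<longrightarrow> ?general)")
proof -
  have k: "k \<ge> 1" and m: "m \<ge> 1" using assms(4,5) by auto
  have car: "V\<^sub>L \<in> carrier_mat n (p * (k - 1))" "V\<^sub>U \<in> carrier_mat n (p * (k - 1))"
    "W\<^sub>L \<in> carrier_mat (q * (m - 1)) n" "W\<^sub>U \<in> carrier_mat (q * (m - 1)) n"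
    by (simp_all add: V\<^sub>L_def V\<^sub>U_def W\<^sub>L_def W\<^sub>U_def)
  have Vb: "Vb 0 \<in> carrier_mat n p" and Wb: "Wb 0 \<in> carrier_mat q n"
    using assms(8)[of 0] assms(10)[of 0] k m by auto
  have real: "V = reach_mat k A B \<and> W = obs_mat m A C \<longleftrightarrow>
      (B, C) = (Vb 0, Wb 0) \<and> A * V\<^sub>L = V\<^sub>U \<and> W\<^sub>L * A = W\<^sub>U"
    if "A \<in> carrier_mat n n" "B \<in> carrier_mat n p" "C \<in> carrier_mat q n" for A B C
    unfolding assms(9,11) V\<^sub>L_def V\<^sub>U_def W\<^sub>L_def W\<^sub>U_def
    by (rule realises_iff[OF k m assms(8,10) that])
  have sol: "A * V\<^sub>L = V\<^sub>U \<and> W\<^sub>L * A = W\<^sub>U \<longleftrightarrow>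
      (\<exists>Z \<in> carrier_mat n n. A = W1 * W\<^sub>U + (1\<^sub>m n - W1 * W\<^sub>L) * V\<^sub>U * V1
         + (1\<^sub>m n - W1 * W\<^sub>L) * Z * (1\<^sub>m n - V\<^sub>L * V1))"
    if ?cond "one_inverse V\<^sub>L V1" "one_inverse W\<^sub>L W1" "A \<in> carrier_mat n n" for A V1 W1
    using that car by (intro common_solution_iff) auto
  have ?cond if ?ex
  proof -
    from that real obtain A where A: "A \<in> carrier_mat n n" "A * V\<^sub>L = V\<^sub>U" "W\<^sub>L * A = W\<^sub>U"
      by blast
    from common_solution_necessary[OF car(1,3) A] show ?thesis by blast
  qed
  moreover have ?ex if ?cond
  proof -
    obtain V1 W1 where inv: "one_inverse V\<^sub>L V1" "one_inverse W\<^sub>L W1"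
      using one_inverse_exists by blast
    define A where "A = W1 * W\<^sub>U + (1\<^sub>m n - W1 * W\<^sub>L) * V\<^sub>U * V1
      + (1\<^sub>m n - W1 * W\<^sub>L) * 0\<^sub>m n n * (1\<^sub>m n - V\<^sub>L * V1)"
    have A: "A \<in> carrier_mat n n"
      using inv car by (auto simp: A_def one_inverse_def)
    have "A * V\<^sub>L = V\<^sub>U \<and> W\<^sub>L * A = W\<^sub>U"
      unfolding sol[OF that inv A] by (auto simp: A_def intro!: bexI[of _ "0\<^sub>m n n"])
    then show ?thesis using real[OF A Vb Wb] A Vb Wb by blast
  qed
  moreover have ?general if ?cond
  proof (intro allI impI ballI)
    fix V1 W1 A B C :: "'a mat"
    assume inv: "one_inverse V\<^sub>L V1 \<and> one_inverse W\<^sub>L W1"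
      and A: "A \<in> carrier_mat n n" and BC: "B \<in> carrier_mat n p" "C \<in> carrier_mat q n"
    from inv have "one_inverse V\<^sub>L V1" "one_inverse W\<^sub>L W1" by auto
    note sol_A = sol[OF that this A]
    show "V = reach_mat k A B \<and> W = obs_mat m A C \<longleftrightarrow> (B, C) = (Vb 0, Wb 0)
        \<and> (\<exists>Z \<in> carrier_mat n n. A = W1 * W\<^sub>U + (1\<^sub>m n - W1 * W\<^sub>L) * V\<^sub>U * V1
              + (1\<^sub>m n - W1 * W\<^sub>L) * Z * (1\<^sub>m n - V\<^sub>L * V1))"
      unfolding real[OF A BC] sol_A ..
  qed
  ultimately show ?thesis by blast
qed

end
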